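(* Let $1\le p<\infty$ and let $T\colon \ell^p\to\ell^p$ be a positive operator. The following statements are equivalent. (i) There exist positive operators $M,N\colon \ell^p\to\ell^p$ such that $T=MN$ and $M^2=N^2=NM=0$. (ii) There exists a positive operator $U\colon\ell^p\to\ell^p$ such that $T=U^2$ and $U^3=0$. (iii) There exists a nontrivial band decomposition $\ell^p=L_1\oplus L_2\oplus L_3$ with respect to which the operator $T$ is of the form $$T=\begin{pmatrix} 0 & 0 & T_{13}\\ 0 & 0 & 0\\ 0 & 0 & 0\end{pmatrix}$$ for some positive operator $T_{13}\colon L_3\to L_1$ with $\operatorname{rank}^+(T_{13})\le\dim(L_2)$.
   Context: $\ell^p$ is the real Banach lattice of $p$-summable sequences with the coordinatewise order. A linear operator between vector lattices is positive if it maps the positive cone of the domain into the positive cone of the codomain. An ideal of a vector lattice $X$ is a subspace $A$ such that $|x|\le|y|$ and $y\in A$ imply $x\in A$; a band is an order closed ideal (in $\ell^p$, $1\le p<\infty$, bands are precisely the norm closed ideals). A band decomposition $\ell^p=L_1\oplus L_2\oplus L_3$ is a decomposition as a direct sum of (pairwise disjoint) bands; it is nontrivial if each of the bands $L_1,L_2,L_3$ is non-zero. Nonnegative rank: for a positive operator $S\colon X\to Y$ between Archimedean vector lattices, $\operatorname{rank}^+(S)$ is the minimal integer $k\ge 0$ such that $S=LR$ for some positive operators $R\colon X\to\mathbb{R}^k$ and $L\colon\mathbb{R}^k\to Y$, where $\mathbb{R}^k$ is ordered coordinatewise; if no such $k$ exists, $\operatorname{rank}^+(S)=\infty$. The dimension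 $\dim(L_2)$ is either a nonnegative integer or $\infty$, and the inequality $\operatorname{rank}^+(T_{13})\le\dim(L_2)$ holds automatically when $\dim(L_2)=\infty$ (including the case $\operatorname{rank}^+(T_{13})=\infty$). *)

theory Defs
  imports Complex_Main "HOL-Library.Function_Algebras" "HOL-Library.Extended_Nat"
begin

text \<open>Pointwise real vector space structure on functions, completing the pointwise addition
  of \<^theory>\<open>HOL-Library.Function_Algebras\<close> and the pointwise order and lattice operations
  of \<^theory>\<open>HOL.Lattices\<close>.\<close>

instantiation "fun" :: (type, real_vector) real_vector
begin

definition "c *\<^sub>R f = (\<lambda>x. c *\<^sub>R f x)"

instance
  by standard (simp_all add: scaleR_fun_def fun_eq_iff scaleR_add_left scaleR_add_right)

end

lemma scaleR_fun_apply [simp]: "(c *\<^sub>R f) x = c *\<^sub>R f x"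
  by (simp add: scaleR_fun_def)

instance "fun" :: (type, ordered_real_vector) ordered_real_vector
  by standard (auto simp: le_fun_def intro: scaleR_left_mono scaleR_right_mono)

text \<open>Vector lattices are represented by carrier sets \<open>X\<close>, namely linear sublattices of an
  ambient vector lattice type. A map between carriers is a total function whose values
  outside its domain are irrelevant.\<close>

definition modulus :: "'a::{ordered_real_vector, lattice} \<Rightarrow> 'a" where
  "modulus x = sup x (- x)"

definition positive_operator ::
  "'a::{ordered_real_vector, lattice} set \<Rightarrow> 'b::{ordered_real_vector, lattice} set
    \<Rightarrow> ('a \<Rightarrow> 'b) \<Rightarrow> bool" where
  "positive_operator X Y T \<longleftrightarrow>
     (\<forall>x\<in>X. T x \<in> Y) \<and>
     (\<forall>x\<in>X. \<forall>y\<in>X. T (x + y) = T x + T y) \<and>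
     (\<forall>c. \<forall>x\<in>X. T (c *\<^sub>R x) = c *\<^sub>R T x) \<and>
     (\<forall>x\<in>X. 0 \<le> x \<longrightarrow> 0 \<le> T x)"

definition lattice_ideal :: "'a::{ordered_real_vector, lattice} set \<Rightarrow> 'a set \<Rightarrow> bool" where
  "lattice_ideal X A \<longleftrightarrow> A \<subseteq> X \<and> subspace A \<and>
     (\<forall>x\<in>X. \<forall>y\<in>A. modulus x \<le> modulus y \<longrightarrow> x \<in> A)"

definition decreases_to_zero :: "'a::{ordered_real_vector, lattice} set \<Rightarrow> 'a set \<Rightarrow> bool" where
  "decreases_to_zero X D \<longleftrightarrow> D \<noteq> {} \<and> D \<subseteq> X \<and>
     (\<forall>d\<in>D. \<forall>e\<in>D. \<exists>f\<in>D. f \<le> d \<and> f \<le> e) \<and>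
     (\<forall>d\<in>D. 0 \<le> d) \<and> (\<forall>z\<in>X. (\<forall>d\<in>D. z \<le> d) \<longrightarrow> z \<le> 0)"

text \<open>Order convergence, with nets rendered by filters: a net order converges to \<open>x\<close> iff there
  is a downward directed set \<open>D\<close> with infimum \<open>0\<close> in \<open>X\<close> such that for each \<open>d \<in> D\<close> the
  terms eventually satisfy \<open>|a - x| \<le> d\<close>. Both the infimum and the limit refer to \<open>X\<close>.\<close>

definition order_converges ::
  "'a::{ordered_real_vector, lattice} set \<Rightarrow> 'a filter \<Rightarrow> 'a \<Rightarrow> bool" where
  "order_converges X F x \<longleftrightarrow> x \<in> X \<and>
     (\<exists>D. decreases_to_zero X D \<and>
        (\<forall>d\<in>D. eventually (\<lambda>a. modulus (a - x) \<le> d) F))"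

definition order_closed :: "'a::{ordered_real_vector, lattice} set \<Rightarrow> 'a set \<Rightarrow> bool" where
  "order_closed X A \<longleftrightarrow>
     (\<forall>F x. F \<noteq> bot \<longrightarrow> eventually (\<lambda>a. a \<in> A) F \<longrightarrow> order_converges X F x \<longrightarrow> x \<in> A)"

definition band :: "'a::{ordered_real_vector, lattice} set \<Rightarrow> 'a set \<Rightarrow> bool" where
  "band X A \<longleftrightarrow> lattice_ideal X A \<and> order_closed X A"

definition disjoint_elements ::
  "'a::{ordered_real_vector, lattice} set \<Rightarrow> 'a set \<Rightarrow> bool" where
  "disjoint_elements A B \<longleftrightarrow> (\<forall>x\<in>A. \<forall>y\<in>B. inf (modulus x) (modulus y) = 0)"

definition band_decomposition ::
  "'a::{ordered_real_vector, lattice} set \<Rightarrow> 'a set \<Rightarrow> 'a set \<Rightarrow> 'a set \<Rightarrow> bool" where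
  "band_decomposition X L1 L2 L3 \<longleftrightarrow>
     band X L1 \<and> band X L2 \<and> band X L3 \<and>
     disjoint_elements L1 L2 \<and> disjoint_elements L1 L3 \<and> disjoint_elements L2 L3 \<and>
     (\<forall>x\<in>X. \<exists>!(y::'a \<times> 'a \<times> 'a). y \<in> L1 \<times> L2 \<times> L3 \<and> x = fst y + fst (snd y) + snd (snd y))"

definition nontrivial_band_decomposition ::
  "'a::{ordered_real_vector, lattice} set \<Rightarrow> 'a set \<Rightarrow> 'a set \<Rightarrow> 'a set \<Rightarrow> bool" where
  "nontrivial_band_decomposition X L1 L2 L3 \<longleftrightarrow>
     band_decomposition X L1 L2 L3 \<and> L1 \<noteq> {0} \<and> L2 \<noteq> {0} \<and> L3 \<noteq> {0}"

text \<open>The library's \<^const>\<open>dim\<close> is \<open>0\<close> on infinite-dimensional spaces.\<close>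

definition edim :: "'a::real_vector set \<Rightarrow> enat" where
  "edim V = (if \<exists>B. finite B \<and> V \<subseteq> span B then enat (dim V) else \<infinity>)"

text \<open>Since \<open>k\<close> varies inside the definition of the nonnegative rank, the space \<open>\<real>\<^sup>k\<close> with the
  coordinatewise order is realised as the sequences vanishing from index \<open>k\<close> on.\<close>

definition coord_space :: "nat \<Rightarrow> (nat \<Rightarrow> real) set" where
  "coord_space k = {v. \<forall>i\<ge>k. v i = 0}"

text \<open>The infimum in \<^typ>\<open>enat\<close> is the minimum on nonempty sets and \<open>\<infinity>\<close> on the empty set.\<close>

definition nonneg_rank ::
  "'a::{ordered_real_vector, lattice} set \<Rightarrow> 'b::{ordered_real_vector, lattice} set
    \<Rightarrow> ('a \<Rightarrow> 'b) \<Rightarrow> enat" where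
  "nonneg_rank X Y S = Inf {enat k | k.
     \<exists>R L. positive_operator X (coord_space k) R \<and> positive_operator (coord_space k) Y L \<and>
       (\<forall>x\<in>X. S x = L (R x))}"

definition lp :: "real \<Rightarrow> (nat \<Rightarrow> real) set" where
  "lp p = {x. summable (\<lambda>n. \<bar>x n\<bar> powr p)}"

end

theory Submission
  imports Defs
begin

text \<open>If \<open>T = M N\<close> as in (i), then \<open>U = M + N\<close> satisfies (ii). Given \<open>U\<close>, let \<open>B1\<close> and \<open>B2\<close> be the
  sets of indices whose unit sequences are annihilated by \<open>U\<close> and by \<open>U\<^sup>2\<close>; positivity and
  \<open>U\<^sup>3 = 0\<close> force \<open>U\<close> to map into the band of \<open>B2\<close> and \<open>U\<^sup>2\<close> into the band of \<open>B1\<close>, so the bands of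
  \<open>B1\<close>, \<open>B2 - B1\<close> and the complement of \<open>B2\<close> form the decomposition in (iii) (any three do if \<open>T = 0\<close>), with
  \<open>U\<^sup>2\<close> factoring through the middle band. Conversely the rank bound makes \<open>T13\<close>
  factor positively through \<open>L2\<close>: an infinite-dimensional \<open>L2\<close> contains a copy of \<open>L1\<close> as a
  positive retract, and a finite-dimensional one contains the coordinate space of a minimal
  factorization. The two factors are \<open>N\<close> and \<open>M\<close>.\<close>

section \<open>Elementary calculus of positive operators between carriers\<close>

lemma positive_operatorI:
  assumes "\<And>x. x \<in> X \<Longrightarrow> T x \<in> Y"
    and "\<And>x y. x \<in> X \<Longrightarrow> y \<in> X \<Longrightarrow> T (x + y) = T x + T y"
    and "\<And>c x. x \<in> X \<Longrightarrow> T (c *\<^sub>R x) = c *\<^sub>R T x"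
    and "\<And>x. x \<in> X \<Longrightarrow> 0 \<le> x \<Longrightarrow> 0 \<le> T x"
  shows "positive_operator X Y T"
  using assms by (auto simp: positive_operator_def)

lemma
  assumes "positive_operator X Y T"
  shows positive_operator_range: "x \<in> X \<Longrightarrow> T x \<in> Y"
    and positive_operator_add: "x \<in> X \<Longrightarrow> y \<in> X \<Longrightarrow> T (x + y) = T x + T y"
    and positive_operator_scaleR: "x \<in> X \<Longrightarrow> T (c *\<^sub>R x) = c *\<^sub>R T x"
    and positive_operator_nonneg: "x \<in> X \<Longrightarrow> 0 \<le> x \<Longrightarrow> 0 \<le> T x"
  using assms by (auto simp: positive_operator_def)

lemma positive_operator_0:
  assumes "positive_operator X Y T" "0 \<in> X"
  shows "T 0 = 0"
  using positive_operator_scaleR[OF assms, of 0] by simp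

lemma positive_operator_diff:
  assumes T: "positive_operator X Y T" and "subspace X" "x \<in> X" "y \<in> X"
  shows "T (x - y) = T x - T y"
proof -
  have "T (x - y) + T y = T (x - y + y)"
    using assms by (intro positive_operator_add[OF T, symmetric] subspace_diff)
  then show ?thesis by (simp add: algebra_simps)
qed

lemma positive_operator_mono:
  assumes T: "positive_operator X Y T" and "subspace X" "x \<in> X" "y \<in> X" "x \<le> y"
  shows "T x \<le> T y"
proof -
  have "0 \<le> T (y - x)"
    using assms by (intro positive_operator_nonneg[OF T] subspace_diff) simp_all
  then show ?thesis using assms by (simp add: positive_operator_diff[OF T])
qed

lemma positive_operator_compose:
  assumes "positive_operator X Y S" "positive_operator Y Z T"
  shows "positive_operator X Z (\<lambda>x. T (S x))"
  using assms by (auto simp: positive_operator_def)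

lemma positive_operator_subset:
  assumes "positive_operator X Y T" "X' \<subseteq> X" "Y \<subseteq> Y'"
  shows "positive_operator X' Y' T"
  using assms unfolding positive_operator_def by (meson subsetD)

lemma positive_operator_sum:
  assumes "positive_operator X Y S" "positive_operator X Y T" "subspace Y"
  shows "positive_operator X Y (\<lambda>x. S x + T x)"
  using assms
  by (intro positive_operatorI)
    (auto simp: positive_operator_range positive_operator_add positive_operator_scaleR
      positive_operator_nonneg scaleR_add_right subspace_add)

lemma positive_operator_zero:
  assumes "0 \<in> Y"
  shows "positive_operator X Y (\<lambda>x. 0)"
  using assms by (intro positive_operatorI) auto

section \<open>Coordinate bands and the operators that move coordinates\<close>

definition lp_on :: "real \<Rightarrow> nat set \<Rightarrow> (nat \<Rightarrow> real) set" where
  "lp_on p A = {x \<in> lp p. \<forall>n. n \<notin> A \<longrightarrow> x n = 0}"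

text \<open>With \<open>g\<close> the identity this is the band projection belonging to
  \<open>A\<close>. Other choices of \<open>g\<close> give the embeddings and retractions between
  coordinate bands, so one family of positive operators covers every map built by hand
  below.\<close>

definition reindex :: "(nat \<Rightarrow> nat) \<Rightarrow> nat set \<Rightarrow> (nat \<Rightarrow> real) \<Rightarrow> nat \<Rightarrow> real" where
  "reindex g A x = (\<lambda>n. if n \<in> A then x (g n) else 0)"

abbreviation restr :: "nat set \<Rightarrow> (nat \<Rightarrow> real) \<Rightarrow> nat \<Rightarrow> real" where
  "restr \<equiv> reindex (\<lambda>n. n)"

definition unit_seq :: "nat \<Rightarrow> nat \<Rightarrow> real" where
  "unit_seq j = (\<lambda>n. if n = j then 1 else 0)"

lemma modulus_apply: "modulus x n = \<bar>x n :: real\<bar>"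
  by (simp add: modulus_def sup_real_def abs_real_def max_def)

lemma lp_on_UNIV [simp]: "lp_on p UNIV = lp p"
  by (simp add: lp_on_def)

lemma lp_on_mono: "A \<subseteq> B \<Longrightarrow> lp_on p A \<subseteq> lp_on p B"
  by (auto simp: lp_on_def)

lemma lp_on_subset: "lp_on p A \<subseteq> lp p"
  by (simp add: lp_on_def)

lemma lp_dominated:
  assumes "y \<in> lp p" "0 < p" "\<And>n. \<bar>x n\<bar> \<le> \<bar>y n\<bar>"
  shows "x \<in> lp p"
  using assms unfolding lp_def
  by (auto intro!: summable_comparison_test'[of "\<lambda>n. \<bar>y n\<bar> powr p" 0] powr_mono2)

lemma finite_support_lp:
  assumes "finite A" "\<And>n. n \<notin> A \<Longrightarrow> x n = 0"
  shows "x \<in> lp p"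
  unfolding lp_def using assms by (auto intro!: summable_finite[of A])

lemma subspace_lp:
  assumes "0 < p"
  shows "subspace (lp p)"
  unfolding subspace_def
proof (intro conjI ballI allI)
  show "0 \<in> lp p" by (simp add: lp_def)
next
  fix x y assume "x \<in> lp p" "y \<in> lp p"
  then have sum: "summable (\<lambda>n. 2 powr p * (\<bar>x n\<bar> powr p + \<bar>y n\<bar> powr p))"
    by (intro summable_mult summable_add) (auto simp: lp_def)
  \<comment> \<open>A crude substitute for Minkowski's inequality, valid for every positive
    \<open>p\<close>: the sum is at most twice the larger modulus, and the power of the larger is at
    most the sum of both powers.\<close>
  have "\<bar>x n + y n\<bar> powr p \<le> 2 powr p * (\<bar>x n\<bar> powr p + \<bar>y n\<bar> powr p)" for n
  proof -
    have "\<bar>x n + y n\<bar> powr p \<le> (2 * max \<bar>x n\<bar> \<bar>y n\<bar>) powr p"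
      using assms by (intro powr_mono2) auto
    also have "\<dots> = 2 powr p * (max \<bar>x n\<bar> \<bar>y n\<bar>) powr p"
      by (simp add: powr_mult)
    also have "\<dots> \<le> 2 powr p * (\<bar>x n\<bar> powr p + \<bar>y n\<bar> powr p)"
      by (intro mult_left_mono) (auto simp: max_def)
    finally show ?thesis .
  qed
  then have "summable (\<lambda>n. \<bar>x n + y n\<bar> powr p)"
    by (intro summable_comparison_test'[OF sum, of 0]) auto
  then show "x + y \<in> lp p"
    by (simp add: lp_def)
next
  fix c x assume "x \<in> lp p"
  then show "c *\<^sub>R x \<in> lp p"
    by (simp add: lp_def abs_mult powr_mult summable_mult)
qed

lemma subspace_lp_on:
  assumes "0 < p"
  shows "subspace (lp_on p A)"
  using subspace_lp[OF assms] by (auto simp: subspace_def lp_on_def)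

lemma unit_seq_lp_on: "j \<in> A \<Longrightarrow> unit_seq j \<in> lp_on p A"
  using finite_support_lp[of "{j}" "unit_seq j"] by (auto simp: lp_on_def unit_seq_def)

lemma unit_seq_lp: "unit_seq j \<in> lp p"
  using unit_seq_lp_on[of j UNIV] by simp

lemma unit_seq_nonneg: "0 \<le> unit_seq j"
  by (simp add: le_fun_def unit_seq_def)

lemma lp_on_nontrivial:
  assumes "A \<noteq> {}"
  shows "lp_on p A \<noteq> {0}"
proof -
  obtain j where "j \<in> A" using assms by auto
  then have "unit_seq j \<in> lp_on p A" by (rule unit_seq_lp_on)
  moreover have "unit_seq j \<noteq> 0" by (auto simp: unit_seq_def fun_eq_iff)
  ultimately show ?thesis by auto
qed

lemma lp_on_empty: "x \<in> lp_on p {} \<Longrightarrow> x = 0"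
  by (auto simp: lp_on_def)

text \<open>Finite support makes summability automatic. Hence the coordinate space used for the
  nonnegative rank is itself a coordinate band, for any \<open>p\<close>, and can be embedded by the
  same reindexing operators.\<close>

lemma coord_space_eq: "coord_space k = lp_on p {..<k}"
  using finite_support_lp[of "{..<k}"] by (auto simp: coord_space_def lp_on_def not_less)

text \<open>Injectivity turns each partial sum into a sum over distinct terms of the series of
  \<open>x\<close>, which is bounded by the full sum.\<close>

lemma reindex_lp_on:
  assumes "x \<in> lp p" "inj_on g A"
  shows "reindex g A x \<in> lp_on p A"
proof -
  let ?f = "\<lambda>n. \<bar>x n\<bar> powr p"
  have f: "summable ?f" using assms by (simp add: lp_def)
  have "(\<Sum>i<n. \<bar>reindex g A x i\<bar> powr p) \<le> suminf ?f" for n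
  proof -
    have "(\<Sum>i<n. \<bar>reindex g A x i\<bar> powr p) = (\<Sum>i\<in>{..<n} \<inter> A. ?f (g i))"
      by (intro sum.mono_neutral_cong_right) (auto simp: reindex_def)
    also have "\<dots> = sum ?f (g ` ({..<n} \<inter> A))"
      using assms(2) by (subst sum.reindex) (auto intro: inj_on_subset)
    also have "\<dots> \<le> suminf ?f"
      using f by (intro sum_le_suminf) auto
    finally show ?thesis .
  qed
  then have "summable (\<lambda>i. \<bar>reindex g A x i\<bar> powr p)"
    by (intro summableI_nonneg_bounded) auto
  then show ?thesis
    by (auto simp: lp_on_def lp_def reindex_def)
qed

lemma positive_operator_reindex:
  assumes "inj_on g A"
  shows "positive_operator (lp p) (lp_on p A) (reindex g A)"
  using assms
  by (intro positive_operatorI) (auto simp: reindex_lp_on, auto simp: reindex_def le_fun_def)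

lemma positive_operator_restr: "positive_operator (lp p) (lp_on p A) (restr A)"
  by (rule positive_operator_reindex) simp

lemma restr_lp_on: "x \<in> lp_on p A \<Longrightarrow> restr A x = x"
  by (auto simp: lp_on_def reindex_def)

lemma restr_lp_on_disjoint: "x \<in> lp_on p A \<Longrightarrow> A \<inter> B = {} \<Longrightarrow> restr B x = 0"
  by (fastforce simp: lp_on_def reindex_def fun_eq_iff)

text \<open>Allows the middle space of a positive factorization to be replaced by a larger one:
  insert \<open>S\<close> and then \<open>P\<close>, whose composition is the identity.\<close>

lemma lp_on_retract:
  assumes "inj_on e J" "e ` J \<subseteq> A"
  obtains S P where "positive_operator (lp_on p J) (lp_on p A) S"
    "positive_operator (lp_on p A) (lp_on p J) P"
    "\<And>x. x \<in> lp_on p J \<Longrightarrow> P (S x) = x"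
proof
  \<comment> \<open>\<open>S\<close> carries coordinate \<open>j\<close> to position
    \<open>e j\<close> and fills the remaining positions with zeros; \<open>inv_into J e\<close> is
    meaningful only on the image of \<open>J\<close>, which is where it is evaluated.
    \<open>P\<close> reads the entries back along \<open>e\<close>.\<close>
  show "positive_operator (lp_on p J) (lp_on p A) (reindex (inv_into J e) (e ` J))"
    by (rule positive_operator_subset[OF positive_operator_reindex lp_on_subset lp_on_mono])
      (use assms in \<open>auto intro: inj_on_inv_into\<close>)
  show "positive_operator (lp_on p A) (lp_on p J) (reindex e J)"
    by (rule positive_operator_subset[OF positive_operator_reindex lp_on_subset order_refl]) fact
  show "reindex e J (reindex (inv_into J e) (e ` J) x) = x" if "x \<in> lp_on p J" for x
    using that assms by (auto simp: reindex_def lp_on_def fun_eq_iff)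
qed

section \<open>Dimension of coordinate bands\<close>

lemma unit_seq_inj: "inj unit_seq"
  by (rule injI) (metis unit_seq_def zero_neq_one)

lemma sum_scaleR_unit_seq:
  assumes "finite F"
  shows "(\<Sum>j\<in>F. c j *\<^sub>R unit_seq j) = (\<lambda>n. if n \<in> F then c n else 0)"
  using assms
  by (induction F rule: finite_induct) (auto simp: unit_seq_def fun_eq_iff)

lemma independent_unit_seq: "independent (unit_seq ` A)"
  unfolding independent_explicit_module
proof (intro allI impI)
  fix F u v
  assume F: "finite F" "F \<subseteq> unit_seq ` A" and 0: "(\<Sum>v\<in>F. u v *\<^sub>R v) = 0" and v: "v \<in> F"
  obtain G where G: "F = unit_seq ` G" "finite G"
    using F finite_subset_image by metis
  obtain j where j: "j \<in> G" "v = unit_seq j" using v G by auto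
  have "(\<Sum>v\<in>F. u v *\<^sub>R v) = (\<Sum>j\<in>G. u (unit_seq j) *\<^sub>R unit_seq j)"
    unfolding G(1) by (rule sum.reindex[unfolded o_def]) (rule inj_on_subset[OF unit_seq_inj subset_UNIV])
  also have "\<dots> = (\<lambda>n. if n \<in> G then u (unit_seq n) else 0)"
    by (rule sum_scaleR_unit_seq) fact
  finally have "(\<lambda>n. if n \<in> G then u (unit_seq n) else 0) = 0" using 0 by simp
  from fun_cong[OF this, of j] show "u v = 0" using j by simp
qed

lemma edim_lp_on_finite:
  assumes "finite A" "0 < p"
  shows "edim (lp_on p A) = enat (card A)"
proof -
  have sub: "lp_on p A \<subseteq> span (unit_seq ` A)"
  proof
    fix x assume "x \<in> lp_on p A"
    then have "x = (\<Sum>j\<in>A. x j *\<^sub>R unit_seq j)"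
      by (subst sum_scaleR_unit_seq) (use assms in \<open>auto simp: lp_on_def fun_eq_iff\<close>)
    then show "x \<in> span (unit_seq ` A)"
      by (metis (no_types, lifting) imageI span_base span_scale span_sum)
  qed
  have "dim (lp_on p A) = card (unit_seq ` A)"
    by (rule dim_unique[OF _ sub independent_unit_seq refl]) (auto intro: unit_seq_lp_on)
  then have "dim (lp_on p A) = card A"
    by (simp add: card_image inj_on_subset[OF unit_seq_inj])
  then show ?thesis
    using sub assms unfolding edim_def by (metis finite_imageI)
qed

text \<open>The span of a finite set cannot contain the infinite independent family of unit
  sequences.\<close>

lemma edim_lp_on_infinite:
  assumes "infinite A"
  shows "edim (lp_on p A) = \<infinity>"
proof -
  have False if "finite B" "lp_on p A \<subseteq> span B" for B
  proof -
    have "unit_seq ` A \<subseteq> span B"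
      using that by (auto intro: unit_seq_lp_on)
    then have "finite (unit_seq ` A)"
      using independent_span_bound[OF that(1) independent_unit_seq] by blast
    then show False
      using assms finite_imageD inj_on_subset[OF unit_seq_inj] by blast
  qed
  then show ?thesis by (auto simp: edim_def)
qed

section \<open>Nonnegative rank and factorization through a coordinate band\<close>

lemma nonneg_rank_factorization:
  assumes "nonneg_rank X Y S \<le> enat n"
  obtains k R L where "k \<le> n" "positive_operator X (coord_space k) R"
    "positive_operator (coord_space k) Y L" "\<And>x. x \<in> X \<Longrightarrow> S x = L (R x)"
proof -
  \<comment> \<open>A strict bound on the infimum yields an actual member of the set below that
    bound, so attainment of the minimum needs no separate argument.\<close>
  have "nonneg_rank X Y S < enat (Suc n)"
    using assms by (metis enat_ord_simps(2) lessI order_le_less_trans)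
  then obtain k R L where "k < Suc n" "positive_operator X (coord_space k) R"
    "positive_operator (coord_space k) Y L" "\<forall>x\<in>X. S x = L (R x)"
    unfolding nonneg_rank_def Inf_less_iff by auto
  then show ?thesis using that[of k R L] by simp
qed

text \<open>For finite \<open>A\<close>, relabelling coordinates turns the middle space into
  \<open>coord_space (card A)\<close>, so the given factorization competes in the infimum. For
  infinite \<open>A\<close> the right-hand side is \<open>\<infinity>\<close>.\<close>

lemma nonneg_rank_le_edim_lp_on:
  assumes R: "positive_operator X (lp_on p A) R" and L: "positive_operator (lp_on p A) Y L"
    and S: "\<And>x. x \<in> X \<Longrightarrow> S x = L (R x)" and p: "0 < p"
  shows "nonneg_rank X Y S \<le> edim (lp_on p A)"
proof (cases "finite A")
  case True
  obtain e where e: "inj_on e A" "e ` A \<subseteq> {..<card A}"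
    using card_le_inj[OF True, of "{..<card A}"] by auto
  obtain I P where IP: "positive_operator (lp_on p A) (lp_on p {..<card A}) I"
    "positive_operator (lp_on p {..<card A}) (lp_on p A) P"
    "\<And>x. x \<in> lp_on p A \<Longrightarrow> P (I x) = x"
    using lp_on_retract[OF e] by blast
  have "positive_operator X (coord_space (card A)) (\<lambda>x. I (R x))"
    "positive_operator (coord_space (card A)) Y (\<lambda>x. L (P x))"
    unfolding coord_space_eq[of _ p]
    using positive_operator_compose R L IP by blast+
  moreover have "\<forall>x\<in>X. S x = L (P (I (R x)))"
    using S IP positive_operator_range[OF R] by simp
  ultimately have "nonneg_rank X Y S \<le> enat (card A)"
    unfolding nonneg_rank_def
    by (intro Inf_lower CollectI exI[of _ "card A"] exI[of _ "\<lambda>x. I (R x)"] exI[of _ "\<lambda>x. L (P x)"] conjI) auto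
  then show ?thesis using edim_lp_on_finite[OF True p] by simp
next
  case False
  then show ?thesis by (simp add: edim_lp_on_infinite)
qed

text \<open>Converse of the previous bound. For finite \<open>A\<close> the rank bound supplies a
  factorization with at most \<open>card A\<close> coordinates, and these fit into \<open>A\<close>.
  For infinite \<open>A\<close> the bound carries no information, but the whole target embeds into
  the band of \<open>A\<close> as a positive retract, so \<open>S\<close> followed by the embedding
  serves as \<open>R\<close> and the retraction as \<open>L\<close>.\<close>

lemma factorization_through_lp_on:
  assumes S: "positive_operator X (lp_on p C) S" and p: "0 < p"
    and rank: "nonneg_rank X (lp_on p C) S \<le> edim (lp_on p A)"
  obtains R L where "positive_operator X (lp_on p A) R" "positive_operator (lp_on p A) (lp_on p C) L"
    "\<And>x. x \<in> X \<Longrightarrow> S x = L (R x)"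
proof (cases "finite A")
  case True
  then obtain k R L where k: "k \<le> card A" and RL: "positive_operator X (lp_on p {..<k}) R"
    "positive_operator (lp_on p {..<k}) (lp_on p C) L" "\<And>x. x \<in> X \<Longrightarrow> S x = L (R x)"
    using rank p by (auto simp: edim_lp_on_finite coord_space_eq[of _ p] elim: nonneg_rank_factorization)
  obtain e where e: "inj_on e {..<k}" "e ` {..<k} \<subseteq> A"
    using card_le_inj[of "{..<k}" A] True k by auto
  obtain I P where IP: "positive_operator (lp_on p {..<k}) (lp_on p A) I"
    "positive_operator (lp_on p A) (lp_on p {..<k}) P"
    "\<And>x. x \<in> lp_on p {..<k} \<Longrightarrow> P (I x) = x"
    using lp_on_retract[OF e] by blast
  show ?thesis
    using positive_operator_compose[OF RL(1) IP(1)] positive_operator_compose[OF IP(2) RL(2)]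
    by (rule that) (simp add: RL(3) IP(3) positive_operator_range[OF RL(1)])
next
  case False
  then obtain e :: "nat \<Rightarrow> nat" where e: "inj e" "range e \<subseteq> A"
    using infinite_countable_subset by blast
  then have eC: "inj_on e C" "e ` C \<subseteq> A" by (auto intro: inj_on_subset)
  obtain I P where IP: "positive_operator (lp_on p C) (lp_on p A) I"
    "positive_operator (lp_on p A) (lp_on p C) P"
    "\<And>x. x \<in> lp_on p C \<Longrightarrow> P (I x) = x"
    using lp_on_retract[OF eC] by blast
  show ?thesis
    using positive_operator_compose[OF S IP(1)] IP(2)
    by (rule that) (simp add: IP(3) positive_operator_range[OF S])
qed

section \<open>Bands and band decompositions of lp\<close>

lemma band_lp_on:
  assumes p: "0 < p"
  shows "band (lp p) (lp_on p A)"
  unfolding band_def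
proof
  show "lattice_ideal (lp p) (lp_on p A)"
    unfolding lattice_ideal_def
  proof (intro conjI ballI impI lp_on_subset subspace_lp_on[OF p])
    fix x y assume x: "x \<in> lp p" and y: "y \<in> lp_on p A" and le: "modulus x \<le> modulus y"
    have "x n = 0" if "n \<notin> A" for n
      using le_funD[OF le, of n] y that by (simp add: modulus_apply lp_on_def)
    then show "x \<in> lp_on p A" using x by (simp add: lp_on_def)
  qed
  show "order_closed (lp p) (lp_on p A)"
    unfolding order_closed_def
  proof (intro allI impI)
    fix F x
    assume F: "F \<noteq> bot" "eventually (\<lambda>a. a \<in> lp_on p A) F" "order_converges (lp p) F x"
    then obtain D where D: "decreases_to_zero (lp p) D"
      "\<And>d. d \<in> D \<Longrightarrow> eventually (\<lambda>a. modulus (a - x) \<le> d) F" and x: "x \<in> lp p"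
      by (auto simp: order_converges_def)
    have "x n = 0" if n: "n \<notin> A" for n
    proof -
      \<comment> \<open>Members of the band vanish at \<open>n\<close>, so at that coordinate
        \<open>modulus (a - x) \<le> d\<close> says \<open>\<bar>x n\<bar> \<le> d n\<close>. The
        multiple of the unit sequence is thus a lower bound of \<open>D\<close> inside
        \<open>lp p\<close>, and infimum zero forces \<open>x n = 0\<close>.\<close>
      have "\<bar>x n\<bar> *\<^sub>R unit_seq n \<le> d" if d: "d \<in> D" for d
      proof -
        have "eventually (\<lambda>a. a \<in> lp_on p A \<and> modulus (a - x) \<le> d) F"
          using F(2) D(2)[OF d] by (rule eventually_conj)
        then obtain a where a: "a \<in> lp_on p A" "modulus (a - x) \<le> d"
          using F(1) eventually_happens' by blast
        have "\<bar>x n\<bar> \<le> d n"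
          using le_funD[OF a(2), of n] a(1) n by (simp add: modulus_apply lp_on_def)
        moreover have "0 \<le> d" using D(1) d by (auto simp: decreases_to_zero_def)
        ultimately show ?thesis by (auto simp: le_fun_def unit_seq_def)
      qed
      moreover have "\<bar>x n\<bar> *\<^sub>R unit_seq n \<in> lp p"
        by (intro subspace_scale subspace_lp p unit_seq_lp)
      ultimately have "\<bar>x n\<bar> *\<^sub>R unit_seq n \<le> 0"
        using D(1) by (auto simp: decreases_to_zero_def)
      from le_funD[OF this, of n] show ?thesis by (simp add: unit_seq_def)
    qed
    then show "x \<in> lp_on p A" using x by (simp add: lp_on_def)
  qed
qed

lemma disjoint_elements_lp_on:
  assumes "A \<inter> B = {}"
  shows "disjoint_elements (lp_on p A) (lp_on p B)"
  unfolding disjoint_elements_def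
proof (intro ballI ext)
  fix x y n assume "x \<in> lp_on p A" "y \<in> lp_on p B"
  then have "x n = 0 \<or> y n = 0" using assms by (auto simp: lp_on_def)
  then show "inf (modulus x) (modulus y) n = 0 n"
    by (auto simp: modulus_apply inf_real_def)
qed

lemma disjoint_elementsD:
  fixes x y :: "nat \<Rightarrow> real"
  assumes "disjoint_elements A B" "x \<in> A" "y \<in> B"
  shows "x n = 0 \<or> y n = 0"
proof -
  have "inf (modulus x) (modulus y) n = 0" using assms by (simp add: disjoint_elements_def)
  then show ?thesis by (auto simp: modulus_apply inf_real_def min_def split: if_splits)
qed

lemma nontrivial_band_decomposition_lp_on:
  assumes p: "0 < p" and A: "A1 \<inter> A2 = {}" "A1 \<inter> A3 = {}" "A2 \<inter> A3 = {}" "A1 \<union> A2 \<union> A3 = UNIV"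
    and ne: "A1 \<noteq> {}" "A2 \<noteq> {}" "A3 \<noteq> {}"
  shows "nontrivial_band_decomposition (lp p) (lp_on p A1) (lp_on p A2) (lp_on p A3)"
  unfolding nontrivial_band_decomposition_def band_decomposition_def
proof (intro conjI ballI band_lp_on[OF p] disjoint_elements_lp_on A lp_on_nontrivial ne)
  fix x assume x: "x \<in> lp p"
  let ?P = "\<lambda>y. y \<in> lp_on p A1 \<times> lp_on p A2 \<times> lp_on p A3 \<and> x = fst y + fst (snd y) + snd (snd y)"
  show "\<exists>!y. ?P y"
  proof (rule ex1I[of _ "(restr A1 x, restr A2 x, restr A3 x)"])
    show "?P (restr A1 x, restr A2 x, restr A3 x)"
    proof
      show "x = fst (restr A1 x, restr A2 x, restr A3 x) + fst (snd (restr A1 x, restr A2 x, restr A3 x))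
          + snd (snd (restr A1 x, restr A2 x, restr A3 x))"
        using A by (auto simp: reindex_def fun_eq_iff)
    qed (use x in \<open>auto intro: reindex_lp_on\<close>)
  next
    fix y assume "?P y"
    then obtain u v w where y: "y = (u, v, w)" and m: "u \<in> lp_on p A1" "v \<in> lp_on p A2" "w \<in> lp_on p A3"
      and s: "x = u + v + w" by (cases y) auto
    have "u n = restr A1 x n \<and> v n = restr A2 x n \<and> w n = restr A3 x n" for n
      using m A unfolding s reindex_def lp_on_def by auto
    then show "y = (restr A1 x, restr A2 x, restr A3 x)" by (auto simp: y)
  qed
qed

text \<open>Decomposing a unit sequence shows that it lies in exactly one of the three ideals.\<close>

lemma band_decomposition_lp_cases:
  assumes bd: "band_decomposition (lp p) L1 L2 L3" and p: "0 < p"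
  obtains A1 A2 A3 where "L1 = lp_on p A1" "L2 = lp_on p A2" "L3 = lp_on p A3"
    "A1 \<inter> A2 = {}" "A1 \<inter> A3 = {}" "A2 \<inter> A3 = {}" "A1 \<union> A2 \<union> A3 = UNIV"
proof -
  have id: "lattice_ideal (lp p) L1" "lattice_ideal (lp p) L2" "lattice_ideal (lp p) L3"
    and dis: "disjoint_elements L1 L2" "disjoint_elements L1 L3" "disjoint_elements L2 L3"
    using bd by (simp_all only: band_decomposition_def band_def)
  have ex1: "\<forall>x\<in>lp p. \<exists>!y. y \<in> L1 \<times> L2 \<times> L3 \<and> x = fst y + fst (snd y) + snd (snd y)"
    using bd unfolding band_decomposition_def by (elim conjE)
  have dec: "\<exists>u\<in>L1. \<exists>v\<in>L2. \<exists>w\<in>L3. x = u + v + w" if "x \<in> lp p" for x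
    using ex1_implies_ex[OF bspec[OF ex1 that]] by auto
  define A where "A L = {n. unit_seq n \<in> L}" for L :: "(nat \<Rightarrow> real) set"
  \<comment> \<open>Rescaling gives \<open>x\<close> modulus 1 at \<open>n\<close>; it then
    dominates \<open>unit_seq n\<close>, which the ideal property puts into
    \<open>L\<close>.\<close>
  have inA: "n \<in> A L" if "lattice_ideal (lp p) L" "x \<in> L" "x n \<noteq> 0" for L x n
  proof -
    have "(inverse \<bar>x n\<bar>) *\<^sub>R x \<in> L"
      using that by (auto simp: lattice_ideal_def intro: subspace_scale)
    moreover have "modulus (unit_seq n) \<le> modulus ((inverse \<bar>x n\<bar>) *\<^sub>R x)"
      using that by (auto simp: le_fun_def modulus_apply unit_seq_def abs_mult)
    ultimately show ?thesis
      using that unit_seq_lp unfolding A_def lattice_ideal_def by blast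
  qed
  have sub: "L \<subseteq> lp_on p (A L)" if "lattice_ideal (lp p) L" for L
    using inA[OF that] that by (auto simp: lp_on_def lattice_ideal_def)
  have disA: "A L \<inter> A L' = {}" if "disjoint_elements L L'" for L L'
  proof -
    have False if "unit_seq n \<in> L" "unit_seq n \<in> L'" for n
      using disjoint_elementsD[OF \<open>disjoint_elements L L'\<close> that, of n] by (simp add: unit_seq_def)
    then show ?thesis by (auto simp: A_def)
  qed
  note disj = disA[OF dis(1)] disA[OF dis(2)] disA[OF dis(3)]
  have cover: "A L1 \<union> A L2 \<union> A L3 = UNIV"
  proof -
    have "n \<in> A L1 \<union> A L2 \<union> A L3" for n
    proof -
      obtain u v w where uvw: "u \<in> L1" "v \<in> L2" "w \<in> L3" "unit_seq n = u + v + w"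
        using dec[OF unit_seq_lp] by blast
      have "u n + v n + w n = 1"
        using fun_cong[OF uvw(4), of n] by (simp add: unit_seq_def)
      then have "u n \<noteq> 0 \<or> v n \<noteq> 0 \<or> w n \<noteq> 0" by auto
      then show ?thesis using inA id uvw by blast
    qed
    then show ?thesis by auto
  qed
  \<comment> \<open>Unit sequences in \<open>L\<close> account only for finite combinations. For the
    inclusion of all of \<open>lp_on p (A L)\<close> in \<open>L\<close>, the components of an
    arbitrary \<open>x\<close> are identified with its restrictions.\<close>
  have restr: "restr (A L1) x \<in> L1 \<and> restr (A L2) x \<in> L2 \<and> restr (A L3) x \<in> L3" if x: "x \<in> lp p" for x
  proof -
    obtain u v w where uvw: "u \<in> L1" "v \<in> L2" "w \<in> L3" "x = u + v + w"
      using dec[OF x] by blast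
    have m: "u \<in> lp_on p (A L1)" "v \<in> lp_on p (A L2)" "w \<in> lp_on p (A L3)"
      using uvw sub id by auto
    have "restr (A L1) x n = u n \<and> restr (A L2) x n = v n \<and> restr (A L3) x n = w n" for n
      using m disj unfolding uvw reindex_def lp_on_def by auto
    then have "restr (A L1) x = u" "restr (A L2) x = v" "restr (A L3) x = w" by auto
    then show ?thesis using uvw by simp
  qed
  have eq: "L1 = lp_on p (A L1)" "L2 = lp_on p (A L2)" "L3 = lp_on p (A L3)"
    using sub id restr restr_lp_on lp_on_subset by (metis subset_antisym subsetD subsetI)+
  show ?thesis by (rule that[OF eq disj cover])
qed

section \<open>Tails of sequences and the action of positive operators on unit sequences\<close>

text \<open>A case of Dini's theorem on convergent series. Each term is the difference of
  consecutive tails \<open>r n\<close> and \<open>r (Suc n)\<close>; factoring it as a difference of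
  squares of roots bounds the quotient by twice the drop of \<open>sqrt (r n)\<close>, and these
  drops telescope.\<close>

lemma summable_div_sqrt_tail:
  fixes a :: "nat \<Rightarrow> real"
  assumes a: "summable a" "\<And>n. 0 \<le> a n"
  shows "summable (\<lambda>n. a n / sqrt (\<Sum>k. a (k + n)))"
proof -
  define r where "r n = (\<Sum>k. a (k + n))" for n
  have r: "0 \<le> r n" for n
    unfolding r_def using a by (intro suminf_nonneg summable_ignore_initial_segment) auto
  have rS: "r n = a n + r (Suc n)" for n
    unfolding r_def using suminf_split_head[OF summable_ignore_initial_segment[OF a(1), of n]] by simp
  have le: "a n / sqrt (r n) \<le> 2 * (sqrt (r n) - sqrt (r (Suc n)))" for n
  proof (cases "r n = 0")
    \<comment> \<open>Division by zero gives 0 on the left, and the next tail vanishes as well, so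
      both sides are 0.\<close>
    case True
    then have "r (Suc n) = 0" using rS[of n] r[of "Suc n"] a(2)[of n] by linarith
    then show ?thesis using True by simp
  next
    case False
    then have pos: "0 < sqrt (r n)" using r[of n] by simp
    have "sqrt (r (Suc n)) \<le> sqrt (r n)" using rS[of n] a(2)[of n] by simp
    have "a n = (sqrt (r n))\<^sup>2 - (sqrt (r (Suc n)))\<^sup>2" using rS[of n] r[of n] r[of "Suc n"] by simp
    also have "\<dots> = (sqrt (r n) - sqrt (r (Suc n))) * (sqrt (r n) + sqrt (r (Suc n)))"
      by (simp add: power2_eq_square algebra_simps)
    also have "\<dots> \<le> (sqrt (r n) - sqrt (r (Suc n))) * (2 * sqrt (r n))"
      using \<open>sqrt (r (Suc n)) \<le> sqrt (r n)\<close> by (intro mult_left_mono) auto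
    finally show ?thesis using pos by (simp add: field_simps)
  qed
  have "(\<Sum>i<n. a i / sqrt (r i)) \<le> 2 * (sqrt (r 0) - sqrt (r n))" for n
  proof (induction n)
    case (Suc n)
    then show ?case using le[of n] by (simp add: algebra_simps)
  qed simp
  then have "(\<Sum>i<n. a i / sqrt (r i)) \<le> 2 * sqrt (r 0)" for n
    using r[of n] by (smt (verit) real_sqrt_ge_zero)
  then have "summable (\<lambda>n. a n / sqrt (r n))"
    using a r by (intro summableI_nonneg_bounded) auto
  then show ?thesis by (simp add: r_def)
qed

text \<open>Makes positive operators continuous along truncations without a boundedness theorem:
  \<open>V (restr {n..} x) \<le> V y / C\<close> for large \<open>n\<close>.\<close>

lemma lp_tails_relatively_uniform:
  assumes x: "x \<in> lp p" "0 \<le> x" and p: "0 < p"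
  obtains y where "y \<in> lp p" "\<And>C. 0 < C \<Longrightarrow> \<exists>n. C *\<^sub>R restr {n..} x \<le> y"
proof -
  define a where "a n = x n powr p" for n
  define r where "r n = (\<Sum>k. a (k + n))" for n
  \<comment> \<open>The exponent makes \<open>\<bar>y n\<bar> powr p\<close> equal to
    \<open>a n / sqrt (r n)\<close>, which is summable by the preceding lemma, while the factor by
    which \<open>y\<close> exceeds \<open>x\<close> grows without bound as the tails shrink.\<close>
  define y where "y n = x n / r n powr (1 / (2 * p))" for n
  have x0: "0 \<le> x n" for n using x(2) by (simp add: le_fun_def)
  have a: "summable a" using x x0 by (simp add: lp_def a_def[abs_def])
  have a0: "0 \<le> a n" for n by (simp add: a_def)
  have r0: "0 \<le> r n" for n
    unfolding r_def using a a0 by (intro suminf_nonneg summable_ignore_initial_segment) auto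
  have "\<bar>y n\<bar> powr p = a n / sqrt (r n)" for n
  proof -
    have "\<bar>y n\<bar> powr p = x n powr p / (r n powr (1 / (2 * p))) powr p"
      unfolding y_def using x0[of n] r0[of n] by (simp add: powr_divide)
    also have "(r n powr (1 / (2 * p))) powr p = sqrt (r n)"
      using p r0[of n] by (simp add: powr_powr powr_half_sqrt)
    finally show ?thesis by (simp add: a_def)
  qed
  then have y: "y \<in> lp p"
    using summable_div_sqrt_tail[OF a a0] by (simp add: lp_def r_def)
  have lim: "r \<longlonglongrightarrow> 0"
    unfolding r_def using suminf_exist_split[OF _ a] by (auto intro!: LIMSEQ_I)
  show ?thesis
  proof (rule that[OF y])
    fix C :: real assume C: "0 < C"
    \<comment> \<open>Below this threshold \<open>r n powr (1 / (2 * p))\<close> is less than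
      \<open>1 / C\<close>, so a nonzero denominator multiplies \<open>x n\<close> by more than
      \<open>C\<close>.\<close>
    have "eventually (\<lambda>n. r n < C powr (- (2 * p))) sequentially"
      using lim C by (intro order_tendstoD) auto
    then obtain n where n: "\<And>m. n \<le> m \<Longrightarrow> r m < C powr (- (2 * p))"
      by (auto simp: eventually_sequentially)
    have "C * restr {n..} x m \<le> y m" for m
    proof (cases "n \<le> m \<and> x m \<noteq> 0")
      case False
      then show ?thesis using x0[of m] by (auto simp: reindex_def y_def)
    next
      case True
      \<comment> \<open>As \<open>x m\<close> is nonzero, this makes \<open>r m\<close> positive, so
        \<open>y m\<close> is not a quotient by zero.\<close>
      have "a m \<le> r m"
      proof -
        have "r m = a m + r (Suc m)"
          unfolding r_def using suminf_split_head[OF summable_ignore_initial_segment[OF a, of m]] by simp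
        then show ?thesis using r0[of "Suc m"] by simp
      qed
      moreover have "0 < a m" using True by (simp add: a_def)
      ultimately have rm: "0 < r m" by simp
      have "r m powr (1 / (2 * p)) \<le> (C powr (- (2 * p))) powr (1 / (2 * p))"
        using n[of m] True rm p by (intro powr_mono2) auto
      also have "\<dots> = 1 / C" using p C by (simp only: powr_powr) (simp add: powr_minus_divide)
      finally have "C * r m powr (1 / (2 * p)) \<le> 1" using C by (simp add: field_simps)
      then have "x m * (C * r m powr (1 / (2 * p))) \<le> x m"
        using mult_left_mono[of _ 1 "x m"] x0[of m] by simp
      then show ?thesis using rm True by (simp add: y_def reindex_def field_simps)
    qed
    then show "\<exists>n. C *\<^sub>R restr {n..} x \<le> y" by (auto simp: le_fun_def)
  qed
qed

lemma lp_on_pos_neg_parts: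
  assumes "x \<in> lp_on p A" "0 < p"
  obtains u v where "u \<in> lp_on p A" "v \<in> lp_on p A" "0 \<le> u" "0 \<le> v" "x = u - v"
proof
  have x: "x \<in> lp p" using assms by (simp add: lp_on_def)
  show "(\<lambda>n. max (x n) 0) \<in> lp_on p A" "(\<lambda>n. max (- x n) 0) \<in> lp_on p A"
    using assms by (auto simp: lp_on_def intro!: lp_dominated[OF x])
  show "x = (\<lambda>n. max (x n) 0) - (\<lambda>n. max (- x n) 0)" by (auto simp: fun_eq_iff max_def)
qed (auto simp: le_fun_def)

text \<open>For \<open>0 \<le> x\<close>, additivity annihilates every initial segment, so
  \<open>V x\<close> equals \<open>V\<close> of each tail. The relatively uniform domination of
  tails gives \<open>C *\<^sub>R V x \<le> V y\<close> for all positive \<open>C\<close>, which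
  forces \<open>V x = 0\<close> coordinatewise. Positive and negative parts give the general
  case.\<close>

lemma positive_operator_vanishes_lp_on:
  assumes V: "positive_operator (lp p) (lp p) V" and p: "0 < p"
    and V0: "\<And>j. j \<in> A \<Longrightarrow> V (unit_seq j) = 0" and x: "x \<in> lp_on p A"
  shows "V x = 0"
proof -
  note sub = subspace_lp[OF p]
  have restr_lp: "restr B x \<in> lp p" if "x \<in> lp p" for B x
    using reindex_lp_on[OF that, of "\<lambda>n. n" B] by (auto simp: lp_on_def)
  have "V x = 0" if x: "x \<in> lp_on p A" and x0: "0 \<le> x" for x
  proof -
    have xl: "x \<in> lp p" using x by (simp add: lp_on_def)
    have init: "V (restr {..<n} x) = 0" for n
    proof (induction n)
      case 0
      have "restr {..<0} x = 0" by (auto simp: reindex_def)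
      then show ?case using positive_operator_0[OF V subspace_0[OF sub]] by (simp only:)
    next
      case (Suc n)
      have "restr {..<Suc n} x = restr {..<n} x + x n *\<^sub>R unit_seq n"
        by (auto simp: reindex_def unit_seq_def fun_eq_iff less_Suc_eq)
      then have "V (restr {..<Suc n} x) = V (restr {..<n} x) + x n *\<^sub>R V (unit_seq n)"
        using sub restr_lp[OF xl] unit_seq_lp
        by (simp add: positive_operator_add[OF V] positive_operator_scaleR[OF V] subspace_scale)
      moreover have "x n *\<^sub>R V (unit_seq n) = 0"
        using V0 x by (cases "n \<in> A") (auto simp: lp_on_def)
      ultimately show ?case using Suc by simp
    qed
    have tail: "V x = V (restr {n..} x)" for n
    proof -
      have "x = restr {..<n} x + restr {n..} x" by (auto simp: reindex_def fun_eq_iff)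
      then have "V x = V (restr {..<n} x) + V (restr {n..} x)"
        using positive_operator_add[OF V restr_lp[OF xl] restr_lp[OF xl]] by metis
      then show ?thesis by (simp add: init)
    qed
    obtain y where y: "y \<in> lp p" "\<And>C. 0 < C \<Longrightarrow> \<exists>n. C *\<^sub>R restr {n..} x \<le> y"
      using lp_tails_relatively_uniform[OF xl x0 p] by blast
    have bound: "C *\<^sub>R V x \<le> V y" if "0 < C" for C
    proof -
      obtain n where n: "C *\<^sub>R restr {n..} x \<le> y" using y(2) \<open>0 < C\<close> by blast
      have "C *\<^sub>R V x = V (C *\<^sub>R restr {n..} x)"
        using tail[of n] restr_lp[OF xl] by (simp add: positive_operator_scaleR[OF V])
      also have "\<dots> \<le> V y"
        by (intro positive_operator_mono[OF V sub] subspace_scale[OF sub] restr_lp xl y n)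
      finally show ?thesis .
    qed
    have "V x m = 0" for m
    proof (rule ccontr)
      assume ne: "V x m \<noteq> 0"
      \<comment> \<open>The sign of \<open>y\<close> is not among the facts obtained;
        \<open>0 \<le> V y m\<close> follows from the bound with constant 1. The constant chosen
        next makes \<open>C * V x m\<close> equal to \<open>V y m + 1\<close>.\<close>
      have nn: "0 \<le> V x m" "0 \<le> V y m"
        using positive_operator_nonneg[OF V xl x0] le_funD[OF bound[of 1], of m]
        by (auto simp: le_fun_def intro: order_trans)
      then have C: "0 < (V y m + 1) / V x m" using ne by simp
      show False using le_funD[OF bound[OF C], of m] ne by simp
    qed
    then show ?thesis by auto
  qed
  moreover obtain u v where "u \<in> lp_on p A" "v \<in> lp_on p A" "0 \<le> u" "0 \<le> v" "x = u - v"
    using lp_on_pos_neg_parts[OF x p] by blast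
  ultimately show ?thesis
    using positive_operator_diff[OF V sub] lp_on_subset by fastforce
qed

text \<open>For \<open>0 \<le> x\<close> the sequence \<open>U x\<close> dominates
  \<open>U x j *\<^sub>R unit_seq j\<close>. Applying \<open>V\<close> squeezes the image of this
  multiple between 0 and \<open>V (U x) = 0\<close>, so a nonzero coordinate \<open>j\<close> can
  occur only where \<open>V\<close> annihilates the unit sequence.\<close>

lemma range_subset_lp_on_kernel:
  assumes U: "positive_operator (lp p) (lp p) U" and V: "positive_operator (lp p) (lp p) V"
    and p: "0 < p" and VU: "\<And>x. x \<in> lp p \<Longrightarrow> V (U x) = 0" and x: "x \<in> lp p"
  shows "U x \<in> lp_on p {j. V (unit_seq j) = 0}"
proof -
  note sub = subspace_lp[OF p]
  have "U x \<in> lp_on p {j. V (unit_seq j) = 0}" if x: "x \<in> lp p" and x0: "0 \<le> x" for x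
  proof -
    have "V (unit_seq j) = 0" if "U x j \<noteq> 0" for j
    proof -
      have Ux: "0 \<le> U x" "U x \<in> lp p"
        using positive_operator_nonneg[OF U x x0] positive_operator_range[OF U x] .
      then have pos: "0 < U x j" using that by (metis le_funD less_le zero_fun_apply)
      have le: "U x j *\<^sub>R unit_seq j \<le> U x"
        using Ux(1) by (auto simp: le_fun_def unit_seq_def)
      have "U x j *\<^sub>R V (unit_seq j) = V (U x j *\<^sub>R unit_seq j)"
        by (simp add: positive_operator_scaleR[OF V unit_seq_lp])
      also have "\<dots> \<le> V (U x)"
        by (intro positive_operator_mono[OF V sub] subspace_scale[OF sub] unit_seq_lp Ux le)
      finally have "U x j *\<^sub>R V (unit_seq j) \<le> 0" using VU[OF x] by simp
      then have "V (unit_seq j) m \<le> 0" for m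
        using pos by (auto simp: le_fun_def mult_le_0_iff dest: spec[of _ m])
      moreover have "0 \<le> V (unit_seq j)"
        by (intro positive_operator_nonneg[OF V] unit_seq_lp unit_seq_nonneg)
      ultimately show ?thesis by (auto simp: le_fun_def fun_eq_iff intro: antisym)
    qed
    then show ?thesis using positive_operator_range[OF U x] by (auto simp: lp_on_def)
  qed
  moreover obtain u v where "u \<in> lp p" "v \<in> lp p" "0 \<le> u" "0 \<le> v" "x = u - v"
    using lp_on_pos_neg_parts[of x p UNIV] x p by auto
  ultimately show ?thesis
    using positive_operator_diff[OF U sub] by (simp add: subspace_diff subspace_lp_on[OF p])
qed

section \<open>The three implications\<close>

lemma square_root_decomposition:
  assumes p: "0 < p" and U: "positive_operator (lp p) (lp p) U"
    and TU: "\<And>x. x \<in> lp p \<Longrightarrow> T x = U (U x)" and U3: "\<And>x. x \<in> lp p \<Longrightarrow> U (U (U x)) = 0"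
  shows "\<exists>L1 L2 L3 T13. nontrivial_band_decomposition (lp p) L1 L2 L3 \<and>
         positive_operator L3 L1 T13 \<and>
         (\<forall>x1\<in>L1. \<forall>x2\<in>L2. \<forall>x3\<in>L3. T (x1 + x2 + x3) = T13 x3) \<and>
         nonneg_rank L3 L1 T13 \<le> edim L2"
proof (cases "\<forall>x\<in>lp p. T x = 0")
  \<comment> \<open>Treated apart because the kernel construction may degenerate: for
    \<open>U = 0\<close> every index lies in \<open>B1\<close>, and the other two bands would be
    zero.\<close>
  case True
  let ?L = "lp_on p"
  have "nontrivial_band_decomposition (lp p) (?L {0}) (?L {1}) (?L (- {0, 1}))"
    by (rule nontrivial_band_decomposition_lp_on[OF p]) (auto intro: exI[of _ 2])
  moreover have zero: "positive_operator X (?L A) (\<lambda>x. 0)" for X :: "(nat \<Rightarrow> real) set" and A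
    by (intro positive_operator_zero subspace_0 subspace_lp_on p)
  moreover have "T (x1 + x2 + x3) = 0"
    if "x1 \<in> ?L {0}" "x2 \<in> ?L {1}" "x3 \<in> ?L (- {0, 1})" for x1 x2 x3
    using True that lp_on_subset subspace_lp[OF p] by (meson subsetD subspace_add)
  moreover have "nonneg_rank (?L (- {0, 1})) (?L {0}) (\<lambda>x. 0) \<le> edim (?L {1})"
    by (rule nonneg_rank_le_edim_lp_on[OF zero zero _ p]) simp
  ultimately show ?thesis by blast
next
  case False
  note sub = subspace_lp[OF p]
  have UU: "positive_operator (lp p) (lp p) (\<lambda>x. U (U x))"
    by (rule positive_operator_compose[OF U U])
  define B1 where "B1 = {j. U (unit_seq j) = 0}"
  define B2 where "B2 = {j. U (U (unit_seq j)) = 0}"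
  have U0: "U 0 = 0" by (rule positive_operator_0[OF U subspace_0[OF sub]])
  have B12: "B1 \<subseteq> B2" by (auto simp: B1_def B2_def U0)
  have van1: "U x = 0" if "x \<in> lp_on p B1" for x
    using positive_operator_vanishes_lp_on[OF U p _ that] by (auto simp: B1_def)
  have van2: "U (U x) = 0" if "x \<in> lp_on p B2" for x
    using positive_operator_vanishes_lp_on[OF UU p _ that] by (auto simp: B2_def)
  \<comment> \<open>The cube is read in two ways: \<open>U\<close> annihilates the range of the
    square, and the square annihilates the range of \<open>U\<close>.\<close>
  have ran1: "U (U x) \<in> lp_on p B1" if "x \<in> lp p" for x
    unfolding B1_def by (rule range_subset_lp_on_kernel[OF UU U p U3 that])
  have ran2: "U x \<in> lp_on p B2" if "x \<in> lp p" for x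
    unfolding B2_def by (rule range_subset_lp_on_kernel[OF U UU p U3 that])
  \<comment> \<open>\<open>U x\<close> has no coordinates outside \<open>B2\<close>, and
    \<open>U\<close> annihilates its \<open>B1\<close> part, so only the middle part matters. The
    outer restriction leaves the value unchanged and makes the second factor visibly map into the
    first band.\<close>
  have fac: "U (U x) = restr B1 (U (restr (B2 - B1) (U x)))" if x: "x \<in> lp p" for x
  proof -
    let ?y = "U x"
    have y: "?y \<in> lp p" by (rule positive_operator_range[OF U x])
    have "?y = restr B1 ?y + restr (B2 - B1) ?y"
      using ran2[OF x] B12 by (auto simp: lp_on_def reindex_def fun_eq_iff)
    then have "U ?y = U (restr B1 ?y) + U (restr (B2 - B1) ?y)"
      using positive_operator_add[OF U] positive_operator_range[OF positive_operator_restr y]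
        lp_on_subset by (metis subsetD)
    also have "U (restr B1 ?y) = 0"
      by (rule van1[OF positive_operator_range[OF positive_operator_restr y]])
    finally have "U ?y = U (restr (B2 - B1) ?y)" by simp
    then show ?thesis using restr_lp_on[OF ran1[OF x]] by simp
  qed
  obtain z where z: "z \<in> lp p" "U (U z) \<noteq> 0" using False TU by auto
  \<comment> \<open>The nonzero \<open>U (U z)\<close> lies in the band of \<open>B1\<close>;
    \<open>B2\<close> being everything would make the square vanish at \<open>z\<close>; and
    \<open>B2\<close> inside \<open>B1\<close> would put \<open>U z\<close> into the kernel of
    \<open>U\<close>.\<close>
  have ne: "B1 \<noteq> {}" "B2 - B1 \<noteq> {}" "- B2 \<noteq> {}"
  proof -
    show "B1 \<noteq> {}" using ran1[OF z(1)] z(2) lp_on_empty by auto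
    show "- B2 \<noteq> {}"
    proof
      assume "- B2 = {}"
      then have "B2 = UNIV" by auto
      then show False using van2[of z] z by simp
    qed
    show "B2 - B1 \<noteq> {}"
    proof
      assume "B2 - B1 = {}"
      then have "U z \<in> lp_on p B1" using ran2[OF z(1)] lp_on_mono[of B2 B1] by auto
      then show False using van1 z by simp
    qed
  qed
  let ?L1 = "lp_on p B1" and ?L2 = "lp_on p (B2 - B1)" and ?L3 = "lp_on p (- B2)"
  have "nontrivial_band_decomposition (lp p) ?L1 ?L2 ?L3"
    by (rule nontrivial_band_decomposition_lp_on[OF p]) (use ne B12 in auto)
  moreover have "positive_operator ?L3 ?L1 (\<lambda>x. U (U x))"
    using UU ran1 lp_on_subset[of p "- B2"] unfolding positive_operator_def by (meson subsetD)
  moreover have "T (x1 + x2 + x3) = U (U x3)"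
    if x: "x1 \<in> ?L1" "x2 \<in> ?L2" "x3 \<in> ?L3" for x1 x2 x3
  proof -
    have l: "x1 \<in> lp p" "x2 \<in> lp p" "x3 \<in> lp p" using x lp_on_subset by auto
    have "U (U x1) = 0" "U (U x2) = 0"
      using van2 x lp_on_mono[OF B12] lp_on_mono[of "B2 - B1" B2] by blast+
    then show ?thesis
      using l by (simp add: TU positive_operator_add[OF UU] subspace_add[OF sub])
  qed
  moreover have "nonneg_rank ?L3 ?L1 (\<lambda>x. U (U x)) \<le> edim ?L2"
  proof (rule nonneg_rank_le_edim_lp_on[OF _ _ _ p])
    show "positive_operator ?L3 ?L2 (\<lambda>x. restr (B2 - B1) (U x))"
      by (rule positive_operator_subset[OF positive_operator_compose[OF U positive_operator_restr]
            lp_on_subset order_refl])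
    show "positive_operator ?L2 ?L1 (\<lambda>x. restr B1 (U x))"
      by (rule positive_operator_subset[OF positive_operator_compose[OF U positive_operator_restr]
            lp_on_subset order_refl])
    show "U (U x) = restr B1 (U (restr (B2 - B1) (U x)))" if "x \<in> ?L3" for x
      using fac that lp_on_subset by blast
  qed
  ultimately show ?thesis by blast
qed

text \<open>Factor \<open>T13\<close> through \<open>L2\<close> and precede each factor by a band
  projection: \<open>N\<close> reads only the \<open>L3\<close> part and lands in \<open>L2\<close>,
  \<open>M\<close> reads only the \<open>L2\<close> part and lands in \<open>L1\<close>. In
  \<open>M M\<close>, \<open>N N\<close> and \<open>N M\<close> the inner operator lands in a band
  that the outer one does not read.\<close>

lemma decomposition_factorization:
  assumes p: "0 < p" and bd: "band_decomposition (lp p) L1 L2 L3"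
    and T13: "positive_operator L3 L1 T13"
    and T: "\<And>x1 x2 x3. x1 \<in> L1 \<Longrightarrow> x2 \<in> L2 \<Longrightarrow> x3 \<in> L3 \<Longrightarrow> T (x1 + x2 + x3) = T13 x3"
    and rank: "nonneg_rank L3 L1 T13 \<le> edim L2"
  shows "\<exists>M N. positive_operator (lp p) (lp p) M \<and> positive_operator (lp p) (lp p) N \<and>
         (\<forall>x\<in>lp p. T x = M (N x)) \<and>
         (\<forall>x\<in>lp p. M (M x) = 0) \<and> (\<forall>x\<in>lp p. N (N x) = 0) \<and> (\<forall>x\<in>lp p. N (M x) = 0)"
proof -
  obtain A1 A2 A3 where L: "L1 = lp_on p A1" "L2 = lp_on p A2" "L3 = lp_on p A3"
    and A: "A1 \<inter> A2 = {}" "A1 \<inter> A3 = {}" "A2 \<inter> A3 = {}" "A1 \<union> A2 \<union> A3 = UNIV"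
    using band_decomposition_lp_cases[OF bd p] by blast
  obtain Q S where Q: "positive_operator L3 L2 Q" and S: "positive_operator L2 L1 S"
    and fac: "\<And>x. x \<in> L3 \<Longrightarrow> T13 x = S (Q x)"
    using factorization_through_lp_on[OF T13[unfolded L(1)] p] rank unfolding L by metis
  have P: "restr A1 x \<in> L1" "restr A2 x \<in> L2" "restr A3 x \<in> L3" if "x \<in> lp p" for x
    using that unfolding L by (auto intro: reindex_lp_on)
  have 0: "Q 0 = 0" "S 0 = 0"
    using positive_operator_0[OF Q] positive_operator_0[OF S] subspace_0[OF subspace_lp_on[OF p]]
    unfolding L by auto
  define M where "M x = S (restr A2 x)" for x
  define N where "N x = Q (restr A3 x)" for x
  have M: "positive_operator (lp p) L1 M"
    unfolding M_def using positive_operator_restr S unfolding L by (rule positive_operator_compose)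
  have N: "positive_operator (lp p) L2 N"
    unfolding N_def using positive_operator_restr Q unfolding L by (rule positive_operator_compose)
  have "T x = M (N x)" if x: "x \<in> lp p" for x
  proof -
    have "x = restr A1 x + restr A2 x + restr A3 x"
      using A by (auto simp: reindex_def fun_eq_iff)
    then have "T x = T13 (restr A3 x)" using T[OF P(1-3)[OF x]] by simp
    also have "\<dots> = S (N x)" using fac P(3)[OF x] by (simp add: N_def)
    also have "\<dots> = M (N x)"
      using restr_lp_on positive_operator_range[OF N x] by (simp add: M_def L)
    finally show ?thesis .
  qed
  moreover have "M (M x) = 0" "N (M x) = 0" "N (N x) = 0" if x: "x \<in> lp p" for x
    using positive_operator_range[OF M x] positive_operator_range[OF N x] A
    by (auto simp: L M_def[of "M x"] N_def[of "M x"] N_def[of "N x"] restr_lp_on_disjoint 0)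
  moreover have "positive_operator (lp p) (lp p) M" "positive_operator (lp p) (lp p) N"
    using positive_operator_subset[OF M order_refl] positive_operator_subset[OF N order_refl]
      lp_on_subset unfolding L by auto
  ultimately show ?thesis by blast
qed

text \<open>Take \<open>U\<close> to be the sum of \<open>M\<close> and \<open>N\<close>. Expanding
  its square leaves only \<open>M N\<close>, and one more factor from the left produces
  \<open>M M N\<close> and \<open>N M N\<close>, both zero.\<close>

lemma sum_square_root:
  assumes p: "0 < p" and M: "positive_operator (lp p) (lp p) M" and N: "positive_operator (lp p) (lp p) N"
    and T: "\<And>x. x \<in> lp p \<Longrightarrow> T x = M (N x)"
    and 0: "\<And>x. x \<in> lp p \<Longrightarrow> M (M x) = 0" "\<And>x. x \<in> lp p \<Longrightarrow> N (N x) = 0"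
      "\<And>x. x \<in> lp p \<Longrightarrow> N (M x) = 0"
  shows "\<exists>U. positive_operator (lp p) (lp p) U \<and>
         (\<forall>x\<in>lp p. T x = U (U x)) \<and> (\<forall>x\<in>lp p. U (U (U x)) = 0)"
proof (intro exI conjI ballI)
  let ?U = "\<lambda>x. M x + N x"
  note sub = subspace_lp[OF p]
  note ran = positive_operator_range[OF M] positive_operator_range[OF N]
  show "positive_operator (lp p) (lp p) ?U" by (rule positive_operator_sum[OF M N sub])
  have UU: "?U (?U x) = M (N x)" if "x \<in> lp p" for x
    using that by (simp add: positive_operator_add[OF M] positive_operator_add[OF N] ran 0)
  show "T x = ?U (?U x)" if "x \<in> lp p" for x
    using UU T that by simp
  show "?U (?U (?U x)) = 0" if "x \<in> lp p" for x
  proof -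
    have "?U (?U (?U x)) = ?U (M (N x))" by (simp only: UU[OF that])
    then show ?thesis using that by (simp add: ran 0)
  qed
qed

theorem theorem3p2:
  fixes p :: real and T :: "(nat \<Rightarrow> real) \<Rightarrow> (nat \<Rightarrow> real)"
  assumes "1 \<le> p"
    and "positive_operator (lp p) (lp p) T"
  shows
    "((\<exists>M N. positive_operator (lp p) (lp p) M \<and> positive_operator (lp p) (lp p) N \<and>
         (\<forall>x\<in>lp p. T x = M (N x)) \<and>
         (\<forall>x\<in>lp p. M (M x) = 0) \<and> (\<forall>x\<in>lp p. N (N x) = 0) \<and> (\<forall>x\<in>lp p. N (M x) = 0))
      \<longleftrightarrow>
      (\<exists>U. positive_operator (lp p) (lp p) U \<and>
         (\<forall>x\<in>lp p. T x = U (U x)) \<and> (\<forall>x\<in>lp p. U (U (U x)) = 0)))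
     \<and>
     ((\<exists>U. positive_operator (lp p) (lp p) U \<and>
         (\<forall>x\<in>lp p. T x = U (U x)) \<and> (\<forall>x\<in>lp p. U (U (U x)) = 0))
      \<longleftrightarrow>
      (\<exists>L1 L2 L3 T13. nontrivial_band_decomposition (lp p) L1 L2 L3 \<and>
         positive_operator L3 L1 T13 \<and>
         (\<forall>x1\<in>L1. \<forall>x2\<in>L2. \<forall>x3\<in>L3. T (x1 + x2 + x3) = T13 x3) \<and>
         nonneg_rank L3 L1 T13 \<le> edim L2))"
    (is "(?i \<longleftrightarrow> ?ii) \<and> (?ii \<longleftrightarrow> ?iii)")
proof -
  have p: "0 < p" using assms(1) by simp
  have "?i \<Longrightarrow> ?ii" using sum_square_root[OF p] by blast
  moreover have "?ii \<Longrightarrow> ?iii" using square_root_decomposition[OF p] by blast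
  moreover have ?i if iii: ?iii
  proof -
    obtain L1 L2 L3 T13 where "nontrivial_band_decomposition (lp p) L1 L2 L3"
      and T13: "positive_operator L3 L1 T13"
        "\<forall>x1\<in>L1. \<forall>x2\<in>L2. \<forall>x3\<in>L3. T (x1 + x2 + x3) = T13 x3"
        "nonneg_rank L3 L1 T13 \<le> edim L2"
      using iii by (elim exE conjE)
    then have "band_decomposition (lp p) L1 L2 L3"
      by (simp only: nontrivial_band_decomposition_def)
    then show ?i
      using T13 by (intro decomposition_factorization[OF p]) simp_all
  qed
  ultimately show ?thesis by blast
qed

end
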